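(* The dimension of the Dressian $\mathrm{Dr}(3,n)$, viewed as a polyhedral complex, is of order $\Theta(n^2)$ as $n\to\infty$.
   Context: The Dressian $\mathrm{Dr}(3,n)\subseteq\mathbb{R}^{\binom{n}{3}}$ is the set of $\lambda$ (indexed by $3$-subsets of $[n]$) such that for all pairwise distinct $h,i,j,k,l\in[n]$ the minimum of $\lambda_{hij}+\lambda_{hkl},\ \lambda_{hik}+\lambda_{hjl},\ \lambda_{hil}+\lambda_{hjk}$ is attained at least twice; equivalently, the set of weight vectors inducing regular matroid subdivisions of the hypersimplex $\Delta(3,n)$. It is a polyhedral fan with an $n$-dimensional lineality space; viewed as a polyhedral complex, it is the pointed fan obtained by factoring out the lineality space, intersected with the unit sphere (so its dimension is one less than the maximal dimension of a cone of the pointed fan). *)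

theory Defs
  imports "HOL-Analysis.Analysis" "HOL-Analysis.Finite_Function_Topology" "HOL-Library.Landau_Symbols"
begin

text \<open>
  Since \<open>n\<close> varies, the space of real vectors indexed by the 3-subsets of \<open>{1..n}\<close> is realised as
  the finite-dimensional subspace \<open>weight_space n\<close> of \<^typ>\<open>nat set \<Rightarrow>\<^sub>0 real\<close>.
\<close>

definition triples :: "nat \<Rightarrow> nat set set" where
  "triples n = {A. A \<subseteq> {1..n} \<and> card A = 3}"

definition weight_space :: "nat \<Rightarrow> (nat set \<Rightarrow>\<^sub>0 real) set" where
  "weight_space n = {w. Poly_Mapping.keys w \<subseteq> triples n}"

definition quintuples :: "nat \<Rightarrow> (nat \<times> nat \<times> nat \<times> nat \<times> nat) set" where
  "quintuples n = {(h, i, j, k, l). {h, i, j, k, l} \<subseteq> {1..n} \<and> distinct [h, i, j, k, l]}"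

text \<open>The pair \<open>(A, B)\<close> stands for the monomial \<open>p\<^sub>A p\<^sub>B\<close> of a three-term Pluecker relation, whose
  tropical evaluation at \<open>w\<close> is \<open>w\<^sub>A + w\<^sub>B\<close>.\<close>

fun monomials :: "nat \<times> nat \<times> nat \<times> nat \<times> nat \<Rightarrow> (nat set \<times> nat set) set" where
  "monomials (h, i, j, k, l) =
     {({h, i, j}, {h, k, l}), ({h, i, k}, {h, j, l}), ({h, i, l}, {h, j, k})}"

fun monomial_weight :: "(nat set \<Rightarrow>\<^sub>0 real) \<Rightarrow> nat set \<times> nat set \<Rightarrow> real" where
  "monomial_weight w (A, B) = Poly_Mapping.lookup w A + Poly_Mapping.lookup w B"

definition minimal_monomials ::
  "(nat set \<Rightarrow>\<^sub>0 real) \<Rightarrow> nat \<times> nat \<times> nat \<times> nat \<times> nat \<Rightarrow> (nat set \<times> nat set) set" where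
  "minimal_monomials w q =
     {m \<in> monomials q. \<forall>m' \<in> monomials q. monomial_weight w m \<le> monomial_weight w m'}"

definition Dressian :: "nat \<Rightarrow> (nat set \<Rightarrow>\<^sub>0 real) set" where
  "Dressian n = {w \<in> weight_space n. \<forall>q \<in> quintuples n. 2 \<le> card (minimal_monomials w q)}"

text \<open>The fan structure is the one induced by the three-term relations: two weight vectors lie in
  the relative interior of the same cone iff, in every relation, the same terms attain the minimum.
  \<open>Dressian_cone n w\<close> is the closed cone having \<open>w\<close> in its relative interior.\<close>

definition Dressian_cone :: "nat \<Rightarrow> (nat set \<Rightarrow>\<^sub>0 real) \<Rightarrow> (nat set \<Rightarrow>\<^sub>0 real) set" where
  "Dressian_cone n w =
     {v \<in> weight_space n. \<forall>q \<in> quintuples n. minimal_monomials w q \<subseteq> minimal_monomials v q}"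

definition Dressian_fan :: "nat \<Rightarrow> (nat set \<Rightarrow>\<^sub>0 real) set set" where
  "Dressian_fan n = Dressian_cone n ` Dressian n"

definition lineality_space :: "nat \<Rightarrow> (nat set \<Rightarrow>\<^sub>0 real) set" where
  "lineality_space n = (\<Inter>C \<in> Dressian_fan n. {v. v \<in> C \<and> - v \<in> C})"

definition weight_inner :: "nat \<Rightarrow> (nat set \<Rightarrow>\<^sub>0 real) \<Rightarrow> (nat set \<Rightarrow>\<^sub>0 real) \<Rightarrow> real" where
  "weight_inner n v w = (\<Sum>A \<in> triples n. Poly_Mapping.lookup v A * Poly_Mapping.lookup w A)"

text \<open>The quotient by the lineality space is realised as its orthogonal complement; each cone
  is the sum of the lineality space and its intersection with that complement.\<close>

definition pointed_fan :: "nat \<Rightarrow> (nat set \<Rightarrow>\<^sub>0 real) set set" where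
  "pointed_fan n =
     (\<lambda>C. {v \<in> C. \<forall>u \<in> lineality_space n. weight_inner n u v = 0}) ` Dressian_fan n"

text \<open>The Euclidean unit sphere is spelled out because \<^const>\<open>norm\<close> on
  \<^typ>\<open>nat set \<Rightarrow>\<^sub>0 real\<close> is the sum norm.\<close>

definition weight_sphere :: "nat \<Rightarrow> (nat set \<Rightarrow>\<^sub>0 real) set" where
  "weight_sphere n = {v \<in> weight_space n. weight_inner n v v = 1}"

definition Dressian_complex :: "nat \<Rightarrow> (nat set \<Rightarrow>\<^sub>0 real) set set" where
  "Dressian_complex n = (\<lambda>C. C \<inter> weight_sphere n) ` pointed_fan n"

text \<open>A cell is the intersection of a cone with the sphere, so its dimension is one less than that
  of its linear span, which is the span of the cone. The apex yields the empty cell, of dimension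
  \<open>-1\<close>.\<close>

definition cell_dim :: "(nat set \<Rightarrow>\<^sub>0 real) set \<Rightarrow> int" where
  "cell_dim X = int (dim X) - 1"

definition Dressian_dim :: "nat \<Rightarrow> int" where
  "Dressian_dim n = Max (cell_dim ` Dressian_complex n)"

lemma finite_triples: "finite (triples n)"
  by (rule finite_subset[of _ "Pow {1..n}"]) (auto simp: triples_def)

lemma finite_quintuples: "finite (quintuples n)"
  by (rule finite_subset[of _ "{1..n} \<times> {1..n} \<times> {1..n} \<times> {1..n} \<times> {1..n}"])
    (auto simp: quintuples_def)

lemma zero_in_Dressian: "0 \<in> Dressian n"
proof -
  have "minimal_monomials 0 q = monomials q" for q
    by (auto simp: minimal_monomials_def)
  moreover have "card (monomials q) = 3" if "q \<in> quintuples n" for q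
    using that by (auto simp: quintuples_def doubleton_eq_iff insert_eq_iff)
  ultimately show ?thesis
    by (simp add: Dressian_def weight_space_def)
qed

lemma Dressian_eq_Union_fan: "Dressian n = \<Union> (Dressian_fan n)"
proof
  show "Dressian n \<subseteq> \<Union> (Dressian_fan n)"
    by (auto simp: Dressian_fan_def Dressian_cone_def Dressian_def)
  show "\<Union> (Dressian_fan n) \<subseteq> Dressian n"
  proof clarify
    fix C v assume "C \<in> Dressian_fan n" "v \<in> C"
    then obtain w where w: "w \<in> Dressian n" "v \<in> Dressian_cone n w"
      by (auto simp: Dressian_fan_def)
    have "2 \<le> card (minimal_monomials v q)" if q: "q \<in> quintuples n" for q
    proof -
      have "finite (monomials q)" by (cases q) simp
      hence "finite (minimal_monomials v q)" by (simp add: minimal_monomials_def)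
      moreover have "minimal_monomials w q \<subseteq> minimal_monomials v q"
        using w(2) q by (simp add: Dressian_cone_def)
      ultimately have "card (minimal_monomials w q) \<le> card (minimal_monomials v q)"
        by (rule card_mono)
      thus ?thesis using w(1) q by (force simp: Dressian_def)
    qed
    thus "v \<in> Dressian n" using w(2) by (simp add: Dressian_def Dressian_cone_def)
  qed
qed

lemma finite_Dressian_fan: "finite (Dressian_fan n)"
proof -
  let ?P = "\<Pi>\<^sub>E q \<in> quintuples n. Pow (monomials q)"
  let ?G = "\<lambda>f. {v \<in> weight_space n. \<forall>q \<in> quintuples n. f q \<subseteq> minimal_monomials v q}"
  have fin: "finite (monomials q)" for q by (cases q) simp
  have "Dressian_cone n w \<in> ?G ` ?P" for w
    by (rule image_eqI[of _ _ "restrict (minimal_monomials w) (quintuples n)"])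
      (auto simp: Dressian_cone_def minimal_monomials_def)
  hence "Dressian_fan n \<subseteq> ?G ` ?P"
    by (auto simp: Dressian_fan_def)
  thus ?thesis
    by (rule finite_subset) (intro finite_imageI finite_PiE finite_quintuples; simp add: fin)
qed

lemma finite_Dressian_complex: "finite (Dressian_complex n)"
  by (simp add: Dressian_complex_def pointed_fan_def finite_Dressian_fan)

lemma Dressian_complex_nonempty: "Dressian_complex n \<noteq> {}"
  using zero_in_Dressian by (auto simp: Dressian_complex_def pointed_fan_def Dressian_fan_def)

end

theory Submission
  imports Defs
begin

text \<open>
  Upper bound: the span of the cone of \<open>w\<close> lies in the space of all \<open>v\<close> that take equal values on the
  terms minimal for \<open>w\<close>. For fixed \<open>h\<close>, each new point \<open>x\<close> adds at most two degrees of freedom to the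
  values \<open>v\<^sub>h\<^sub>i\<^sub>j\<close>, so those are determined by \<open>2n\<close> coordinates and \<open>v\<close> itself by \<open>2n\<^sup>2\<close> coordinates.

  Lower bound: let \<open>S\<close> be a set of triples of which any two share at most one element. Distinct terms
  of a three-term relation involve triples sharing two elements, so at most one term meets \<open>S\<close>, and all
  nonnegative weights supported on \<open>S\<close> lie in one common cone. The triples \<open>{i, m + j, 2m + i + j}\<close>
  with \<open>1 \<le> i, j \<le> m = \<lfloor>n/4\<rfloor>\<close> give such a set of quadratic size, while factoring out the lineality
  space costs only \<open>O(n)\<close> dimensions.
\<close>

section \<open>Coordinates and dimension\<close>

lemma lookup_scaleR:
  "Poly_Mapping.lookup (c *\<^sub>R x) a = c *\<^sub>R Poly_Mapping.lookup x a"
proof -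
  have "finite {i. c *\<^sub>R Poly_Mapping.lookup x i \<noteq> 0}"
    by (rule finite_subset[OF _ finite_keys[of x]]) (auto simp: in_keys_iff)
  thus ?thesis
    by (simp add: scaleR_poly_mapping_def)
qed

lemma linear_restrict_coordinates:
  "linear (\<lambda>v :: 'a \<Rightarrow>\<^sub>0 real. \<Sum>a\<in>T. Poly_Mapping.single a (Poly_Mapping.lookup v a))"
proof (rule linearI)
  fix b1 b2 :: "'a \<Rightarrow>\<^sub>0 real"
  show "(\<Sum>a\<in>T. Poly_Mapping.single a (Poly_Mapping.lookup (b1 + b2) a)) =
      (\<Sum>a\<in>T. Poly_Mapping.single a (Poly_Mapping.lookup b1 a)) +
      (\<Sum>a\<in>T. Poly_Mapping.single a (Poly_Mapping.lookup b2 a))"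
    by (simp add: lookup_add single_add sum.distrib)
next
  fix r and b :: "'a \<Rightarrow>\<^sub>0 real"
  have "Poly_Mapping.single a (r * y) = r *\<^sub>R Poly_Mapping.single a y" for a :: 'a and y :: real
    by (rule poly_mapping_eqI) (simp add: lookup_scaleR lookup_single when_def)
  thus "(\<Sum>a\<in>T. Poly_Mapping.single a (Poly_Mapping.lookup (r *\<^sub>R b) a)) =
      r *\<^sub>R (\<Sum>a\<in>T. Poly_Mapping.single a (Poly_Mapping.lookup b a))"
    by (simp add: lookup_scaleR scaleR_sum_right)
qed

lemma lookup_restrict_coordinates:
  assumes "finite T"
  shows "Poly_Mapping.lookup (\<Sum>a\<in>T. Poly_Mapping.single a (f a)) b = (f b when b \<in> T)"
  using assms by (simp add: lookup_sum lookup_single when_def sum.delta)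

text \<open>All unit vectors other than the one at \<open>a\<close> lie in the hyperplane where
  coordinate \<open>a\<close> vanishes, hence so does their span.\<close>

lemma independent_singles:
  "independent ((\<lambda>a. Poly_Mapping.single a (1::real)) ` S)"
proof -
  let ?s = "\<lambda>a. Poly_Mapping.single a (1::real)"
  have "?s a \<notin> span (?s ` S - {?s a})" if "a \<in> S" for a
  proof
    assume "?s a \<in> span (?s ` S - {?s a})"
    moreover have "span (?s ` S - {?s a}) \<subseteq> {v. Poly_Mapping.lookup v a = 0}"
    proof (rule span_minimal)
      show "?s ` S - {?s a} \<subseteq> {v. Poly_Mapping.lookup v a = 0}"
        by (auto simp: lookup_single when_def)
      show "subspace {v :: 'a \<Rightarrow>\<^sub>0 real. Poly_Mapping.lookup v a = 0}"
        by (simp add: subspace_def lookup_add lookup_scaleR)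
    qed
    ultimately show False by auto
  qed
  thus ?thesis by (auto simp: dependent_def)
qed

text \<open>By \<open>det\<close>, restriction to the coordinates in \<open>T\<close> is injective
  on \<open>V\<close>, so it maps a basis of \<open>X\<close> to independent vectors in the span of
  \<open>card T\<close> unit vectors. The ambient space may have infinite dimension and an infinite
  basis has \<open>card\<close> 0, so \<open>finite B\<close> carries information of its
  own.\<close>

lemma basis_le_determining_coordinates:
  fixes V X :: "('a \<Rightarrow>\<^sub>0 real) set"
  assumes V: "subspace V" "X \<subseteq> V" and T: "finite T"
    and det: "\<And>v. v \<in> V \<Longrightarrow> (\<forall>a\<in>T. Poly_Mapping.lookup v a = 0) \<Longrightarrow> v = 0"
  obtains B where "B \<subseteq> X" "finite B" "X \<subseteq> span B" "card B = dim X" "card B \<le> card T"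
proof -
  obtain B where B: "B \<subseteq> X" "independent B" "X \<subseteq> span B" "card B = dim X"
    by (rule basis_exists)
  let ?P = "\<lambda>v :: 'a \<Rightarrow>\<^sub>0 real. \<Sum>a\<in>T. Poly_Mapping.single a (Poly_Mapping.lookup v a)"
  let ?s = "\<lambda>a. Poly_Mapping.single a (1::real)"
  have spanB: "span B \<subseteq> V"
    using V B(1) by (intro span_minimal) auto
  have inj: "inj_on ?P (span B)"
  proof (rule inj_onI)
    fix x y assume xy: "x \<in> span B" "y \<in> span B" "?P x = ?P y"
    have "Poly_Mapping.lookup (x - y) a = 0" if "a \<in> T" for a
      using arg_cong[OF xy(3), of "\<lambda>z. Poly_Mapping.lookup z a"] that T
      by (simp add: lookup_restrict_coordinates lookup_minus)
    moreover have "x - y \<in> V"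
      using xy spanB V(1) by (auto intro: subspace_diff)
    ultimately have "x - y = 0"
      by (intro det) auto
    thus "x = y" by simp
  qed
  have indep: "independent (?P ` B)"
    by (rule linear_independent_injective_image[OF linear_restrict_coordinates B(2) inj])
  have "?P v \<in> span (?s ` T)" for v
  proof (rule span_sum)
    fix a assume "a \<in> T"
    have "Poly_Mapping.single a (Poly_Mapping.lookup v a) = Poly_Mapping.lookup v a *\<^sub>R ?s a"
      by (rule poly_mapping_eqI) (simp add: lookup_scaleR lookup_single when_def)
    thus "Poly_Mapping.single a (Poly_Mapping.lookup v a) \<in> span (?s ` T)"
      using \<open>a \<in> T\<close> by (auto intro: span_scale span_base)
  qed
  hence "finite (?P ` B) \<and> card (?P ` B) \<le> card (?s ` T)"
    using T by (intro independent_span_bound indep) auto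
  moreover have "inj_on ?P B"
    using inj span_superset by (rule inj_on_subset)
  moreover have "card (?s ` T) \<le> card T"
    by (rule card_image_le[OF T])
  ultimately have "finite B" "card B \<le> card T"
    by (auto simp: card_image finite_image_iff)
  with B that show thesis by blast
qed

section \<open>The linear span of a cone\<close>

lemma monomial_weight_alt:
  "monomial_weight w m = Poly_Mapping.lookup w (fst m) + Poly_Mapping.lookup w (snd m)"
  by (cases m) simp

lemma monomial_weight_add:
  "monomial_weight (v + w) m = monomial_weight v m + monomial_weight w m"
  by (simp add: monomial_weight_alt lookup_add)

lemma monomial_weight_scaleR:
  "monomial_weight (c *\<^sub>R v) m = c * monomial_weight v m"
  by (simp add: monomial_weight_alt lookup_scaleR algebra_simps)

lemma subspace_weight_space: "subspace (weight_space n)"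
proof -
  have "weight_space n = {w. \<forall>A. A \<notin> triples n \<longrightarrow> Poly_Mapping.lookup w A = 0}"
    by (auto simp: weight_space_def subset_iff in_keys_iff)
  thus ?thesis
    by (simp add: subspace_def lookup_add lookup_scaleR)
qed

text \<open>A linear relaxation of the cone of \<open>w\<close>: the equalities between minimal
  terms are kept and the inequalities dropped.\<close>

definition initial_space :: "nat \<Rightarrow> (nat set \<Rightarrow>\<^sub>0 real) \<Rightarrow> (nat set \<Rightarrow>\<^sub>0 real) set" where
  "initial_space n w = {v \<in> weight_space n. \<forall>q \<in> quintuples n.
     \<forall>m \<in> minimal_monomials w q. \<forall>m' \<in> minimal_monomials w q.
       monomial_weight v m = monomial_weight v m'}"

lemma subspace_initial_space: "subspace (initial_space n w)"
proof -
  have "subspace {v. \<forall>q \<in> quintuples n.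
     \<forall>m \<in> minimal_monomials w q. \<forall>m' \<in> minimal_monomials w q.
       monomial_weight v m = monomial_weight v m'}"
  proof (rule subspaceI, goal_cases)
    case 1
    show ?case by (simp add: monomial_weight_alt)
  next
    case (2 x y)
    thus ?case unfolding mem_Collect_eq monomial_weight_add by metis
  next
    case (3 c x)
    thus ?case unfolding mem_Collect_eq monomial_weight_scaleR by metis
  qed
  from subspace_inter[OF subspace_weight_space this] show ?thesis
    by (simp add: initial_space_def Int_def)
qed

lemma Dressian_cone_subset_initial_space: "Dressian_cone n w \<subseteq> initial_space n w"
proof
  fix v assume v: "v \<in> Dressian_cone n w"
  have "monomial_weight v m = monomial_weight v m'"
    if "q \<in> quintuples n" "m \<in> minimal_monomials w q" "m' \<in> minimal_monomials w q" for q m m'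
  proof -
    have "m \<in> minimal_monomials v q" "m' \<in> minimal_monomials v q"
      using v that by (auto simp: Dressian_cone_def)
    thus ?thesis by (auto simp: minimal_monomials_def intro: antisym)
  qed
  thus "v \<in> initial_space n w"
    using v unfolding Dressian_cone_def initial_space_def by blast
qed

lemma initial_space_eq_0I:
  assumes "v \<in> initial_space n w" "\<And>A. A \<in> triples n \<Longrightarrow> Poly_Mapping.lookup v A = 0"
  shows "v = 0"
proof (rule poly_mapping_eqI)
  fix A
  show "Poly_Mapping.lookup v A = Poly_Mapping.lookup 0 A"
    using assms by (cases "A \<in> triples n") (auto simp: initial_space_def weight_space_def in_keys_iff)
qed

section \<open>Upper bound\<close>

text \<open>At least two of the three terms are minimal for \<open>w\<close>. Which two depends on
  \<open>w\<close> alone, so the choice of disjunct is uniform in \<open>v\<close>.\<close>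

lemma initial_space_two_equal:
  assumes w: "w \<in> Dressian n" and q: "(h, x, i, j, k) \<in> quintuples n"
    and V: "V = initial_space n w"
  shows "(\<forall>v\<in>V. monomial_weight v ({h,x,i},{h,j,k}) = monomial_weight v ({h,x,j},{h,i,k})) \<or>
    (\<forall>v\<in>V. monomial_weight v ({h,x,i},{h,j,k}) = monomial_weight v ({h,x,k},{h,i,j})) \<or>
    (\<forall>v\<in>V. monomial_weight v ({h,x,j},{h,i,k}) = monomial_weight v ({h,x,k},{h,i,j}))"
proof -
  let ?q = "(h, x, i, j, k)"
  have "finite (minimal_monomials w ?q)"
    by (simp add: minimal_monomials_def)
  moreover have "\<not> card (minimal_monomials w ?q) \<le> Suc 0"
    using w q by (force simp: Dressian_def)
  ultimately obtain m m' where m: "m \<in> minimal_monomials w ?q" "m' \<in> minimal_monomials w ?q" "m \<noteq> m'"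
    by (auto simp: card_le_Suc0_iff_eq)
  define R where "R m m' \<longleftrightarrow> (\<forall>v\<in>V. monomial_weight v m = monomial_weight v m')" for m m'
  have R: "R m m'"
    using m q unfolding R_def unfolding V initial_space_def by blast
  have "m \<in> monomials ?q" "m' \<in> monomials ?q"
    using m unfolding minimal_monomials_def by blast+
  moreover have "R a b \<or> R a c \<or> R b c" if "m \<in> {a, b, c}" "m' \<in> {a, b, c}" for a b c
    using that R m(3) by (auto simp: R_def)
  ultimately show ?thesis
    unfolding monomials.simps R_def[symmetric] by blast
qed

text \<open>The induction step: if \<open>v\<close> vanishes on the triples through \<open>h\<close> inside \<open>X\<close>, then among \<open>v\<^sub>h\<^sub>x\<^sub>i\<close>, \<open>v\<^sub>h\<^sub>x\<^sub>j\<close>, \<open>v\<^sub>h\<^sub>x\<^sub>k\<close> two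
  are forced to agree, at places independent of \<open>v\<close>. Hence all \<open>v\<^sub>h\<^sub>x\<^sub>k\<close> are determined by two of them,
  chosen at a pair \<open>i, j\<close> where agreement is not forced.\<close>

lemma star_determining_triples:
  assumes w: "w \<in> Dressian n" and h: "h \<in> {1..n}"
    and X: "finite X" "X \<subseteq> {1..n} - {h}"
  shows "\<exists>T. finite T \<and> card T \<le> 2 * card X \<and>
    (\<forall>v \<in> initial_space n w. (\<forall>A\<in>T. Poly_Mapping.lookup v A = 0) \<longrightarrow>
       (\<forall>i\<in>X. \<forall>j\<in>X. i \<noteq> j \<longrightarrow> Poly_Mapping.lookup v {h,i,j} = 0))"
  using X
proof (induction X rule: finite_induct)
  case empty
  show ?case by (rule exI[of _ "{}"]) simp
next
  case (insert x X)
  define K where "K = {v \<in> initial_space n w.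
    \<forall>i\<in>X. \<forall>j\<in>X. i \<noteq> j \<longrightarrow> Poly_Mapping.lookup v {h,i,j} = 0}"
  define adj where "adj i j \<longleftrightarrow>
    (\<forall>v\<in>K. Poly_Mapping.lookup v {h,x,i} = Poly_Mapping.lookup v {h,x,j})" for i j
  obtain T where T: "finite T" "card T \<le> 2 * card X"
    "\<And>v. v \<in> initial_space n w \<Longrightarrow> \<forall>A\<in>T. Poly_Mapping.lookup v A = 0 \<Longrightarrow> v \<in> K"
    using insert unfolding K_def by auto
  \<comment> \<open>In each term of the relation at \<open>(h, x, i, j, k)\<close> the triple
    without \<open>x\<close> contributes 0 on \<open>K\<close>. Equality of two terms thus becomes
    equality at two triples through \<open>h\<close> and \<open>x\<close>.\<close>
  have adj: "adj i j \<or> adj i k \<or> adj j k"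
    if "i \<in> X" "j \<in> X" "k \<in> X" "i \<noteq> j" "i \<noteq> k" "j \<noteq> k" for i j k
  proof -
    have "(h, x, i, j, k) \<in> quintuples n"
      using that insert.prems insert.hyps h by (auto simp: quintuples_def)
    note two = initial_space_two_equal[OF w this refl]
    have adjI: "adj a b"
      if "\<forall>v\<in>initial_space n w. monomial_weight v ({h,x,a}, {h,c,d}) = monomial_weight v ({h,x,b}, {h,e,f})"
        "c \<in> X" "d \<in> X" "e \<in> X" "f \<in> X" "c \<noteq> d" "e \<noteq> f" for a b c d e f
      unfolding adj_def
    proof
      fix v assume "v \<in> K"
      hence "v \<in> initial_space n w" "Poly_Mapping.lookup v {h,c,d} = 0"
        "Poly_Mapping.lookup v {h,e,f} = 0"
        using that(2-) unfolding K_def by blast+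
      with that(1) show "Poly_Mapping.lookup v {h,x,a} = Poly_Mapping.lookup v {h,x,b}"
        by force
    qed
    from two show ?thesis
      using adjI[of i j k j i k] adjI[of i j k k i j] adjI[of j i k k i j] that by blast
  qed
  obtain U where U: "finite U" "card U \<le> 2"
    "\<And>v k. v \<in> K \<Longrightarrow> \<forall>A\<in>U. Poly_Mapping.lookup v A = 0 \<Longrightarrow> k \<in> X \<Longrightarrow>
       Poly_Mapping.lookup v {h,x,k} = 0"
  proof (cases "\<exists>i\<in>X. \<exists>j\<in>X. i \<noteq> j \<and> \<not> adj i j")
    case True
    then obtain i j where ij: "i \<in> X" "j \<in> X" "i \<noteq> j" "\<not> adj i j" by blast
    show thesis
    proof (rule that[of "{{h,x,i},{h,x,j}}"])
      fix v k assume v: "v \<in> K" "\<forall>A\<in>{{h,x,i},{h,x,j}}. Poly_Mapping.lookup v A = 0" "k \<in> X"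
      have "k = i \<or> k = j \<or> adj i k \<or> adj j k"
        using adj[of i j k] ij v(3) by auto
      thus "Poly_Mapping.lookup v {h,x,k} = 0"
        using v by (auto simp: adj_def)
    qed (auto simp: card_insert_if)
  next
    \<comment> \<open>Agreement is forced for all pairs, vacuously if \<open>X\<close> has at most
      one point, so a single coordinate suffices.\<close>
    case False
    show thesis
    proof (cases "X = {}")
      case True
      thus thesis using that[of "{}"] by simp
    next
      case ne: False
      then obtain i where "i \<in> X" by blast
      with False have "k \<in> X \<Longrightarrow> k = i \<or> adj i k" for k by auto
      thus thesis
        by (intro that[of "{{h,x,i}}"]) (auto simp: adj_def, metis)
    qed
  qed
  show ?case
  proof (intro exI[of _ "T \<union> U"] conjI ballI impI)
    show "finite (T \<union> U)" using T U by simp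
    show "card (T \<union> U) \<le> 2 * card (insert x X)"
      using card_Un_le[of T U] T(2) U(2) insert.hyps by simp
    fix v i j
    assume v: "v \<in> initial_space n w" "\<forall>A\<in>T \<union> U. Poly_Mapping.lookup v A = 0"
      and ij: "i \<in> insert x X" "j \<in> insert x X" "i \<noteq> j"
    have K: "v \<in> K" using T(3) v by auto
    have x: "k \<in> X \<Longrightarrow> Poly_Mapping.lookup v {h,x,k} = 0" for k
      using U(3)[OF K] v by auto
    show "Poly_Mapping.lookup v {h,i,j} = 0"
    proof (cases "i = x \<or> j = x")
      case True
      thus ?thesis using ij x[of i] x[of j] by (auto simp: insert_commute)
    next
      case False
      thus ?thesis using ij K by (auto simp: K_def)
    qed
  qed
qed

text \<open>Every triple passes through some \<open>h\<close>, so the union over \<open>h\<close> of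
  the at most \<open>n\<close> sets of size at most \<open>2 * n\<close> is determining.\<close>

lemma initial_space_determining_triples:
  assumes w: "w \<in> Dressian n"
  shows "\<exists>T. finite T \<and> card T \<le> 2 * n^2 \<and>
    (\<forall>v \<in> initial_space n w. (\<forall>A\<in>T. Poly_Mapping.lookup v A = 0) \<longrightarrow> v = 0)"
proof -
  have "\<exists>T. finite T \<and> card T \<le> 2 * n \<and>
    (\<forall>v \<in> initial_space n w. (\<forall>A\<in>T. Poly_Mapping.lookup v A = 0) \<longrightarrow>
       (\<forall>i\<in>{1..n} - {h}. \<forall>j\<in>{1..n} - {h}. i \<noteq> j \<longrightarrow> Poly_Mapping.lookup v {h,i,j} = 0))"
    if h: "h \<in> {1..n}" for h
  proof -
    have "card ({1..n} - {h}) \<le> n"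
      by (metis card_Diff1_le card_atLeastAtMost diff_Suc_1)
    with star_determining_triples[OF w h, of "{1..n} - {h}"] show ?thesis
      by (auto intro: order_trans)
  qed
  then obtain T where T: "\<And>h. h \<in> {1..n} \<Longrightarrow> finite (T h) \<and> card (T h) \<le> 2 * n \<and>
    (\<forall>v \<in> initial_space n w. (\<forall>A\<in>T h. Poly_Mapping.lookup v A = 0) \<longrightarrow>
       (\<forall>i\<in>{1..n} - {h}. \<forall>j\<in>{1..n} - {h}. i \<noteq> j \<longrightarrow> Poly_Mapping.lookup v {h,i,j} = 0))"
    by metis
  show ?thesis
  proof (intro exI[of _ "\<Union>h\<in>{1..n}. T h"] conjI ballI impI)
    show "finite (\<Union>h\<in>{1..n}. T h)" using T by blast
    have "card (\<Union>h\<in>{1..n}. T h) \<le> (\<Sum>h\<in>{1..n}. card (T h))"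
      by (rule card_UN_le) simp
    also have "\<dots> \<le> (\<Sum>h\<in>{1..n}. 2 * n)"
      using T by (intro sum_mono) blast
    finally show "card (\<Union>h\<in>{1..n}. T h) \<le> 2 * n^2"
      by (simp add: power2_eq_square mult_ac)
  next
    fix v assume v: "v \<in> initial_space n w" "\<forall>A\<in>(\<Union>h\<in>{1..n}. T h). Poly_Mapping.lookup v A = 0"
    show "v = 0"
    proof (rule initial_space_eq_0I[OF v(1)])
      fix A assume "A \<in> triples n"
      then obtain h i j where A: "A = {h,i,j}" "h \<noteq> i" "h \<noteq> j" "i \<noteq> j" "A \<subseteq> {1..n}"
        by (auto simp: triples_def card_3_iff)
      hence "h \<in> {1..n}" by simp
      with T[OF this] v A show "Poly_Mapping.lookup v A = 0" by auto
    qed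
  qed
qed

lemma Dressian_dim_le: "Dressian_dim n \<le> 2 * int n ^ 2"
proof -
  have "cell_dim X \<le> 2 * int n ^ 2" if X: "X \<in> Dressian_complex n" for X
  proof -
    from X obtain w where w: "w \<in> Dressian n" "X \<subseteq> Dressian_cone n w"
      by (auto simp: Dressian_complex_def pointed_fan_def Dressian_fan_def)
    from initial_space_determining_triples[OF w(1)] obtain T
      where T: "finite T" "card T \<le> 2 * n^2"
        "\<forall>v \<in> initial_space n w. (\<forall>A\<in>T. Poly_Mapping.lookup v A = 0) \<longrightarrow> v = 0" by blast
    have "X \<subseteq> initial_space n w"
      using w(2) Dressian_cone_subset_initial_space by blast
    from basis_le_determining_coordinates[OF subspace_initial_space this T(1)] T(3)
    have "dim X \<le> card T" by metis
    with T(2) have "int (dim X) \<le> int (2 * n^2)" by linarith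
    thus ?thesis by (simp add: cell_dim_def)
  qed
  thus ?thesis
    unfolding Dressian_dim_def using finite_Dressian_complex Dressian_complex_nonempty by simp
qed

section \<open>The lineality space\<close>

lemma Dressian_cone_add:
  assumes "u \<in> Dressian_cone n w" "v \<in> Dressian_cone n w"
  shows "u + v \<in> Dressian_cone n w"
proof -
  have "u + v \<in> weight_space n"
    using assms subspace_add[OF subspace_weight_space] by (auto simp: Dressian_cone_def)
  moreover have "m \<in> minimal_monomials (u + v) q"
    if "q \<in> quintuples n" "m \<in> minimal_monomials w q" for q m
  proof -
    have "m \<in> minimal_monomials u q" "m \<in> minimal_monomials v q"
      using assms that by (auto simp: Dressian_cone_def)
    thus ?thesis
      by (auto simp: minimal_monomials_def monomial_weight_add intro: add_mono)
  qed
  ultimately show ?thesis by (auto simp: Dressian_cone_def)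
qed

lemma Dressian_cone_scaleR:
  assumes "v \<in> Dressian_cone n w" "0 \<le> c"
  shows "c *\<^sub>R v \<in> Dressian_cone n w"
proof -
  have "c *\<^sub>R v \<in> weight_space n"
    using assms subspace_scale[OF subspace_weight_space] by (auto simp: Dressian_cone_def)
  moreover have "minimal_monomials v q \<subseteq> minimal_monomials (c *\<^sub>R v) q" for q
    using assms(2)
    by (auto simp: minimal_monomials_def monomial_weight_scaleR intro: mult_left_mono)
  ultimately show ?thesis
    using assms(1) unfolding Dressian_cone_def by blast
qed

text \<open>The vectors of a convex cone whose negatives also lie in it form a subspace, and
  subspaces are closed under intersection.\<close>

lemma subspace_lineality_space: "subspace (lineality_space n)"
proof -
  have "subspace {v. v \<in> C \<and> - v \<in> C}" if "C \<in> Dressian_fan n" for C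
  proof -
    from that obtain w where C: "C = Dressian_cone n w" and w: "w \<in> Dressian n"
      by (auto simp: Dressian_fan_def)
    show ?thesis
    proof (rule subspaceI)
      have "w \<in> C" using w by (simp add: C Dressian_cone_def Dressian_def)
      from Dressian_cone_scaleR[of w n w 0] this
      show "0 \<in> {v. v \<in> C \<and> - v \<in> C}" by (simp add: C)
    next
      fix x y assume "x \<in> {v. v \<in> C \<and> - v \<in> C}" "y \<in> {v. v \<in> C \<and> - v \<in> C}"
      thus "x + y \<in> {v. v \<in> C \<and> - v \<in> C}"
        using Dressian_cone_add[of x n w y] Dressian_cone_add[of "- x" n w "- y"]
        by (simp add: C)
    next
      fix c x assume x: "x \<in> {v. v \<in> C \<and> - v \<in> C}"
      show "c *\<^sub>R x \<in> {v. v \<in> C \<and> - v \<in> C}"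
      proof (cases "0 \<le> c")
        case True
        thus ?thesis
          using x Dressian_cone_scaleR[of x n w c] Dressian_cone_scaleR[of "- x" n w c]
          by (simp add: C)
      next
        \<comment> \<open>A negative scalar exchanges the roles of \<open>x\<close> and
          \<open>- x\<close>.\<close>
        case False
        thus ?thesis
          using x Dressian_cone_scaleR[of x n w "- c"] Dressian_cone_scaleR[of "- x" n w "- c"]
          by (simp add: C)
      qed
    qed
  qed
  thus ?thesis
    unfolding lineality_space_def by (intro subspace_Inter) auto
qed

text \<open>For weight 0 all three terms of each relation are minimal, so
  \<open>initial_space n 0\<close> demands every equality between terms. This inclusion serves to
  bound the dimension of the lineality space from above.\<close>

lemma lineality_space_subset_initial_space: "lineality_space n \<subseteq> initial_space n 0"
proof -
  have "lineality_space n \<subseteq> Dressian_cone n 0"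
    using zero_in_Dressian by (auto simp: lineality_space_def Dressian_fan_def)
  thus ?thesis using Dressian_cone_subset_initial_space by blast
qed

lemma initial_space_zero_eq:
  assumes "v \<in> initial_space n 0" "(h, i, j, k, l) \<in> quintuples n"
  shows "Poly_Mapping.lookup v {h,i,j} + Poly_Mapping.lookup v {h,k,l} =
    Poly_Mapping.lookup v {h,i,k} + Poly_Mapping.lookup v {h,j,l}"
proof -
  have "minimal_monomials 0 q = monomials q" for q
    by (auto simp: minimal_monomials_def)
  hence "({h,i,j},{h,k,l}) \<in> minimal_monomials 0 (h,i,j,k,l)"
    "({h,i,k},{h,j,l}) \<in> minimal_monomials 0 (h,i,j,k,l)"
    by simp_all
  hence "monomial_weight v ({h,i,j},{h,k,l}) = monomial_weight v ({h,i,k},{h,j,l})"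
    using assms unfolding initial_space_def by blast
  thus ?thesis by simp
qed

text \<open>The relations propagate zeros from triples with at least two elements in
  \<open>{1,2,3}\<close> to those with one (\<open>one\<close>), and from there to those with
  none.\<close>

lemma initial_space_zero_determined:
  assumes v: "v \<in> initial_space n 0"
    and vanish: "\<And>k. Poly_Mapping.lookup v {1,2,k} = 0"
      "\<And>k. Poly_Mapping.lookup v {1,3,k} = 0" "\<And>k. Poly_Mapping.lookup v {2,3,k} = 0"
  shows "v = 0"
proof (rule initial_space_eq_0I[OF v])
  have one: "Poly_Mapping.lookup v {x,i,j} = 0"
    if "x \<in> {1,2,3}" "4 \<le> i" "4 \<le> j" "i \<le> n" "j \<le> n" "i \<noteq> j" for x i j
  proof -
    have "card ({1,2,3} - {x}) = 2"
      using that(1) by auto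
    then obtain y z where yz: "y \<in> {1,2,3}" "z \<in> {1,2,3}" "x \<noteq> y" "x \<noteq> z" "y \<noteq> z"
      unfolding card_2_iff by blast
    have pair: "Poly_Mapping.lookup v {a,b,k} = 0" if "a \<in> {1,2,3}" "b \<in> {1,2,3}" "a \<noteq> b" for a b k
      using that vanish[of k] by (auto simp: insert_commute)
    have "(x, i, j, y, z) \<in> quintuples n"
      using that yz by (auto simp: quintuples_def)
    from initial_space_zero_eq[OF v this]
    show ?thesis
      using pair[of x y z] pair[of x y i] pair[of x z j] that(1) yz by (simp add: insert_commute)
  qed
  fix A assume "A \<in> triples n"
  then obtain x y z where A: "A = {x,y,z}" "x \<noteq> y" "x \<noteq> z" "y \<noteq> z" "A \<subseteq> {1..n}"
    by (auto simp: triples_def card_3_iff)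
  \<comment> \<open>Once \<open>A\<close> is sorted, the number of its elements among 1, 2, 3 can be
    read off by comparing \<open>a\<close> and \<open>b\<close> with 4.\<close>
  obtain a b c where abc: "A = {a,b,c}" "a < b" "b < c"
  proof -
    consider "x<y" "y<z" | "x<z" "z<y" | "y<x" "x<z" | "y<z" "z<x" | "z<x" "x<y" | "z<y" "y<x"
      using A(2-4) by linarith
    thus thesis using that A(1) by cases (auto simp: insert_commute)
  qed
  have r: "1 \<le> a" "c \<le> n" using abc A(5) by auto
  consider "4 \<le> a" | "a \<le> 3" "4 \<le> b" | "b \<le> 3" by linarith
  thus "Poly_Mapping.lookup v A = 0"
  proof cases
    case 1
    have "(a, b, c, 1, 2) \<in> quintuples n"
      using 1 abc r by (auto simp: quintuples_def)
    from initial_space_zero_eq[OF v this] show ?thesis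
      using one[of 1 a b] one[of 2 a c] vanish(1)[of a] 1 abc r by (simp add: insert_commute)
  next
    case 2
    hence "a \<in> {1,2,3}" using r by auto
    with one[of a b c] 2 abc r show ?thesis by simp
  next
    case 3
    hence "a = 1 \<and> b = 2 \<or> a = 1 \<and> b = 3 \<or> a = 2 \<and> b = 3" using abc r by auto
    thus ?thesis using vanish[of c] abc by auto
  qed
qed

text \<open>Any linear bound is enough against a quadratic main term; \<open>3 * n\<close> counts
  the sets \<open>{1,2,k}\<close>, \<open>{1,3,k}\<close>, \<open>{2,3,k}\<close> without regard to
  coincidences.\<close>

lemma lineality_space_basis:
  obtains B where "B \<subseteq> lineality_space n" "finite B" "lineality_space n \<subseteq> span B" "card B \<le> 3 * n"
proof -
  define T where "T = (\<lambda>k. {1,2,k}) ` {1..n} \<union> (\<lambda>k. {1,3,k}) ` {1..n} \<union> (\<lambda>k. {2,3,k}) ` {1..n}"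
  have card: "card (f ` {1..n}) \<le> n" for f :: "nat \<Rightarrow> nat set"
    using card_image_le[of "{1..n}" f] by simp
  have T: "finite T" "card T \<le> 3 * n"
  proof -
    show "finite T" by (simp add: T_def)
    show "card T \<le> 3 * n"
      unfolding T_def
      by (rule order_trans[OF card_Un_le], rule order_trans[OF add_right_mono[OF card_Un_le]])
        (use card[of "\<lambda>k. {1,2,k}"] card[of "\<lambda>k. {1,3,k}"] card[of "\<lambda>k. {2,3,k}"] in linarith)
  qed
  have det: "v = 0" if v: "v \<in> initial_space n 0" "\<forall>A\<in>T. Poly_Mapping.lookup v A = 0" for v
  proof -
    have "Poly_Mapping.lookup v {a,b,k} = 0" if "(a,b) \<in> {(1,2),(1,3),(2,3)}" for a b k
    proof (cases "k \<in> {1..n}")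
      case True
      thus ?thesis using that v(2) by (auto simp: T_def)
    next
      \<comment> \<open>Outside \<open>triples n\<close> every \<open>v\<close> in
        \<open>weight_space n\<close> is 0, which lets \<open>k\<close> range over all
        naturals.\<close>
      case False
      hence "{a,b,k} \<notin> triples n" by (auto simp: triples_def)
      thus ?thesis using v(1) by (auto simp: initial_space_def weight_space_def in_keys_iff)
    qed
    thus ?thesis by (intro initial_space_zero_determined[OF v(1)]) auto
  qed
  obtain B where "B \<subseteq> lineality_space n" "finite B" "lineality_space n \<subseteq> span B" "card B \<le> card T"
    using basis_le_determining_coordinates[OF subspace_initial_space
        lineality_space_subset_initial_space T(1) det] by metis
  with T(2) that show thesis by (meson order_trans)
qed

section \<open>Orthogonal projection for the form \<open>weight_inner\<close>\<close>

lemma weight_inner_commute: "weight_inner n u v = weight_inner n v u"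
  by (simp add: weight_inner_def mult.commute)

lemma weight_inner_add_right:
  "weight_inner n u (v + w) = weight_inner n u v + weight_inner n u w"
  by (simp add: weight_inner_def lookup_add algebra_simps sum.distrib)

lemma weight_inner_scaleR_right: "weight_inner n u (c *\<^sub>R v) = c * weight_inner n u v"
  by (simp add: weight_inner_def lookup_scaleR sum_distrib_left mult_ac)

lemma weight_inner_diff_right:
  "weight_inner n u (v - w) = weight_inner n u v - weight_inner n u w"
  by (simp add: weight_inner_def lookup_minus algebra_simps sum_subtractf)

text \<open>The form sees only coordinates in \<open>triples n\<close> and is merely semidefinite on
  the whole type; isotropic vectors lie in its radical.\<close>

lemma weight_inner_self_eq_0:
  assumes "weight_inner n u u = 0"
  shows "weight_inner n v u = 0"
proof -
  have "\<forall>A\<in>triples n. Poly_Mapping.lookup u A * Poly_Mapping.lookup u A = 0"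
    using assms by (simp add: weight_inner_def sum_nonneg_eq_0_iff finite_triples)
  thus ?thesis by (simp add: weight_inner_def)
qed

lemma weight_inner_span_right:
  assumes "\<And>b. b \<in> B \<Longrightarrow> weight_inner n v b = 0" "u \<in> span B"
  shows "weight_inner n v u = 0"
proof -
  have "subspace {u. weight_inner n v u = 0}"
    by (auto simp: subspace_def weight_inner_add_right weight_inner_scaleR_right)
      (simp add: weight_inner_def)
  with assms show ?thesis
    using span_minimal[of B "{u. weight_inner n v u = 0}"] by auto
qed

text \<open>One Gram-Schmidt step per element: \<open>b\<close> is made orthogonal to
  \<open>B\<close>, giving \<open>b'\<close>, and then the component of \<open>v - uv\<close> along
  \<open>b'\<close> is removed.\<close>

lemma orthogonal_projection_exists:
  assumes "finite B"
  shows "\<exists>u \<in> span B. \<forall>b\<in>B. weight_inner n (v - u) b = 0"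
  using assms
proof (induction B arbitrary: v rule: finite_induct)
  case empty
  show ?case by (auto intro: span_zero)
next
  case (insert b B)
  obtain ub where ub: "ub \<in> span B" "\<And>a. a \<in> B \<Longrightarrow> weight_inner n (b - ub) a = 0"
    using insert.IH[of b] by blast
  obtain uv where uv: "uv \<in> span B" "\<And>a. a \<in> B \<Longrightarrow> weight_inner n (v - uv) a = 0"
    using insert.IH[of v] by blast
  define b' where "b' = b - ub"
  \<comment> \<open>If \<open>b'\<close> is isotropic, division by zero gives \<open>c = 0\<close>,
    which is right because \<open>b'\<close> is then orthogonal to everything.\<close>
  define c where "c = weight_inner n (v - uv) b' / weight_inner n b' b'"
  let ?r = "v - (uv + c *\<^sub>R b')"
  have r: "weight_inner n ?r a = weight_inner n (v - uv) a - c * weight_inner n b' a" for a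
    using weight_inner_commute[of n _ a]
    by (simp add: weight_inner_diff_right weight_inner_add_right weight_inner_scaleR_right)
  have B: "weight_inner n ?r a = 0" if "a \<in> B" for a
    using that ub(2) uv(2) by (simp add: r flip: b'_def)
  have "weight_inner n ?r b' = 0"
    unfolding r using weight_inner_self_eq_0[of n b' "v - uv"]
    by (cases "weight_inner n b' b' = 0") (simp_all add: c_def)
  moreover have "weight_inner n ?r ub = 0"
    using B ub(1) by (rule weight_inner_span_right)
  ultimately have "weight_inner n ?r b = 0"
    by (simp add: b'_def weight_inner_diff_right)
  moreover have "uv + c *\<^sub>R b' \<in> span (insert b B)"
  proof -
    have "uv \<in> span (insert b B)" "ub \<in> span (insert b B)"
      using ub(1) uv(1) span_mono[of B "insert b B"] by auto
    thus ?thesis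
      unfolding b'_def by (intro span_add span_scale span_diff) (auto intro: span_base)
  qed
  ultimately show ?case using B by blast
qed

section \<open>Lower bound\<close>

text \<open>Each ray generator is a lineality vector plus a multiple of a point of the cell
  \<open>X\<close>. So \<open>card S\<close> independent vectors lie in the span of bases of
  \<open>X\<close> and of the lineality space, whence \<open>card S \<le> dim X + 3 * n\<close>; the
  final 1 comes from \<open>cell_dim\<close>.\<close>

lemma Dressian_dim_ge_card_rays:
  assumes w: "w \<in> Dressian n" and S: "finite S"
    and singles: "\<And>A. A \<in> S \<Longrightarrow> Poly_Mapping.single A 1 \<in> Dressian_cone n w"
  shows "int (card S) - 3 * int n - 1 \<le> Dressian_dim n"
proof -
  let ?L = "lineality_space n" and ?C = "Dressian_cone n w"
  let ?s = "\<lambda>A. Poly_Mapping.single A (1::real)"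
  define D where "D = {v \<in> ?C. \<forall>u \<in> ?L. weight_inner n u v = 0}"
  define X where "X = D \<inter> weight_sphere n"
  have X: "X \<in> Dressian_complex n"
    using w by (auto simp: X_def D_def Dressian_complex_def pointed_fan_def Dressian_fan_def)
  obtain BL where BL: "BL \<subseteq> ?L" "finite BL" "?L \<subseteq> span BL" "card BL \<le> 3 * n"
    by (rule lineality_space_basis)
  \<comment> \<open>Determining triples ensure that the basis of \<open>X\<close> is finite.\<close>
  obtain T where T: "finite T"
    "\<forall>v \<in> initial_space n w. (\<forall>A\<in>T. Poly_Mapping.lookup v A = 0) \<longrightarrow> v = 0"
    using initial_space_determining_triples[OF w] by blast
  have "X \<subseteq> initial_space n w"
    using Dressian_cone_subset_initial_space by (auto simp: X_def D_def)
  from basis_le_determining_coordinates[OF subspace_initial_space this T(1)] T(2)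
  obtain B where B: "finite B" "X \<subseteq> span B" "card B = dim X" by metis
  have "?s A \<in> span (B \<union> BL)" if "A \<in> S" for A
  proof -
    obtain u where u: "u \<in> span BL" "\<And>b. b \<in> BL \<Longrightarrow> weight_inner n (?s A - u) b = 0"
      using orthogonal_projection_exists[OF BL(2)] by blast
    have uL: "u \<in> ?L"
      using u(1) span_minimal[OF BL(1) subspace_lineality_space] by blast
    \<comment> \<open>The lineality space lies in every cone together with its negatives, so
      subtracting the projection \<open>u\<close> does not leave the cone.\<close>
    hence "- u \<in> ?C"
      using w by (auto simp: lineality_space_def Dressian_fan_def)
    from Dressian_cone_add[OF singles[OF that] this] have C: "?s A - u \<in> ?C" by simp
    have orth: "weight_inner n a (?s A - u) = 0" if "a \<in> ?L" for a
      using weight_inner_span_right[OF u(2), where u = a] that BL(3) weight_inner_commute by auto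
    have "?s A - u \<in> span B"
    \<comment> \<open>Cells contain only unit vectors, so a nonzero difference is normalised before
      it is found in \<open>X\<close>.\<close>
    proof (cases "weight_inner n (?s A - u) (?s A - u) = 0")
      case True
      hence "\<forall>a\<in>triples n. Poly_Mapping.lookup (?s A - u) a = 0"
        by (simp add: weight_inner_def sum_nonneg_eq_0_iff finite_triples)
      hence "?s A - u = 0"
        using C Dressian_cone_subset_initial_space by (blast intro: initial_space_eq_0I)
      thus ?thesis by (simp add: span_zero)
    next
      case False
      let ?y = "?s A - u"
      have "weight_inner n ?y ?y \<ge> 0"
        by (simp add: weight_inner_def sum_nonneg)
      with False have pos: "weight_inner n ?y ?y > 0" by simp
      define c where "c = 1 / sqrt (weight_inner n ?y ?y)"
      have c: "c > 0" using pos by (simp add: c_def)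
      have "weight_inner n (c *\<^sub>R ?y) (c *\<^sub>R ?y) = c * (c * weight_inner n ?y ?y)"
        using weight_inner_commute[of n "c *\<^sub>R ?y" ?y]
        by (simp only: weight_inner_scaleR_right)
      also have "\<dots> = 1"
        using pos by (simp add: c_def field_simps)
      finally have "c *\<^sub>R ?y \<in> X"
        using Dressian_cone_scaleR[OF C, of c] c orth
        by (auto simp: X_def D_def weight_sphere_def weight_inner_scaleR_right Dressian_cone_def)
      hence "c *\<^sub>R ?y \<in> span B"
        using B(2) by blast
      hence "(1 / c) *\<^sub>R (c *\<^sub>R ?y) \<in> span B"
        by (rule span_scale)
      thus ?thesis using c by simp
    qed
    hence "(?s A - u) + u \<in> span (B \<union> BL)"
      using u(1) span_mono[of B "B \<union> BL"] span_mono[of BL "B \<union> BL"]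
      by (intro span_add) auto
    thus ?thesis by simp
  qed
  hence "finite (?s ` S) \<and> card (?s ` S) \<le> card (B \<union> BL)"
    using B(1) BL(2) by (intro independent_span_bound independent_singles) auto
  moreover have "inj_on ?s S"
    by (rule inj_onI) (metis lookup_single_eq lookup_single_not_eq zero_neq_one)
  ultimately have "card S \<le> dim X + 3 * n"
    using card_Un_le[of B BL] B(3) BL(4) by (simp add: card_image)
  hence "int (card S) - 3 * int n - 1 \<le> cell_dim X"
    by (simp add: cell_dim_def)
  also have "\<dots> \<le> Dressian_dim n"
    unfolding Dressian_dim_def using finite_Dressian_complex X by simp
  finally show ?thesis .
qed

text \<open>The indicator weight of \<open>S\<close> serves as \<open>w\<close>. Its minimal terms
  are those avoiding \<open>S\<close>; they still have the least weight 0 under each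
  \<open>single A 1\<close> with \<open>A\<close> in \<open>S\<close>, so these rays lie in the cone
  of \<open>w\<close>.\<close>

lemma partial_triple_system_lower_bound:
  assumes S: "S \<subseteq> triples n"
    and meet: "\<And>A B a b. A \<in> S \<Longrightarrow> B \<in> S \<Longrightarrow> {a,b} \<subseteq> A \<inter> B \<Longrightarrow> a \<noteq> b \<Longrightarrow> A = B"
  shows "int (card S) - 3 * int n - 1 \<le> Dressian_dim n"
proof -
  have fin: "finite S" using S finite_triples finite_subset by blast
  define w where "w = (\<Sum>A\<in>S. Poly_Mapping.single A (1::real))"
  have w: "Poly_Mapping.lookup w A = (if A \<in> S then 1 else 0)" for A
    using lookup_restrict_coordinates[OF fin, of "\<lambda>_. 1" A] by (simp add: w_def when_def)
  let ?Z = "\<lambda>q. {m \<in> monomials q. fst m \<notin> S \<and> snd m \<notin> S}"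
  have Z: "2 \<le> card (?Z q)" if q: "q \<in> quintuples n" for q
  proof -
    obtain h i j k l where ql: "q = (h,i,j,k,l)" by (cases q)
    have d: "distinct [h,i,j,k,l]" using q by (simp add: quintuples_def ql)
    have ne: "{h,a,b} \<noteq> {h,a,c}" if "distinct [h,a,b,c]" for a b c
    proof
      assume "{h,a,b} = {h,a,c}"
      hence "b \<in> {h,a,c}" by blast
      with that show False by auto
    qed
    have nb: "{h,a,b} \<notin> S \<or> {h,a,c} \<notin> S" if "distinct [h,a,b,c]" for a b c
      using meet[of "{h,a,b}" "{h,a,c}" h a] ne[OF that] that by auto
    let ?m1 = "({h,i,j},{h,k,l})" and ?m2 = "({h,i,k},{h,j,l})" and ?m3 = "({h,i,l},{h,j,k})"
    \<comment> \<open>Each triple of one term shares \<open>h\<close> and a second element with each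
      triple of another. The twelve instances of \<open>nb\<close> run through these pairs, so at
      most one term meets \<open>S\<close>.\<close>
    have "?m1 \<in> ?Z q \<and> ?m2 \<in> ?Z q \<or> ?m1 \<in> ?Z q \<and> ?m3 \<in> ?Z q \<or> ?m2 \<in> ?Z q \<and> ?m3 \<in> ?Z q"
      using nb[of i j k] nb[of j i l] nb[of k l i] nb[of l k j]
        nb[of i j l] nb[of j i k] nb[of l k i] nb[of k l j]
        nb[of i k l] nb[of k i j] nb[of l j i] nb[of j l k] d
      by (simp add: ql insert_commute) argo
    moreover have "?m1 \<noteq> ?m2" "?m1 \<noteq> ?m3" "?m2 \<noteq> ?m3"
      using ne[of i j k] ne[of i j l] ne[of i k l] d by auto
    moreover have "2 \<le> card (?Z q)" if "m \<in> ?Z q" "m' \<in> ?Z q" "m \<noteq> m'" for m m'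
    proof -
      have "finite (?Z q)" by (simp add: ql)
      from card_mono[OF this, of "{m, m'}"] that show ?thesis by simp
    qed
    ultimately show ?thesis by meson
  qed
  have min_w: "minimal_monomials w q = ?Z q" if q: "q \<in> quintuples n" for q
  proof -
    \<comment> \<open>A term avoiding \<open>S\<close> exists, so the minimum for \<open>w\<close>
      is exactly 0.\<close>
    obtain z where "z \<in> ?Z q"
      using Z[OF q] by (metis (no_types, lifting) card.empty equals0I not_numeral_le_zero)
    thus ?thesis
      by (auto simp: minimal_monomials_def monomial_weight_alt w split: if_splits)
  qed
  have "w \<in> weight_space n"
    using S by (auto simp: weight_space_def in_keys_iff w split: if_splits)
  hence wD: "w \<in> Dressian n"
    using Z min_w by (simp add: Dressian_def)
  have "Poly_Mapping.single A 1 \<in> Dressian_cone n w" if A: "A \<in> S" for A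
  proof -
    have "Poly_Mapping.single A (1::real) \<in> weight_space n"
      using A S by (auto simp: weight_space_def)
    moreover have "minimal_monomials w q \<subseteq> minimal_monomials (Poly_Mapping.single A 1) q"
      if "q \<in> quintuples n" for q
      unfolding min_w[OF that] using A
      by (auto simp: minimal_monomials_def monomial_weight_alt lookup_single when_def)
    ultimately show ?thesis by (auto simp: Dressian_cone_def)
  qed
  with wD fin show ?thesis by (rule Dressian_dim_ge_card_rays)
qed

lemma Dressian_dim_ge: "int (n div 4) ^ 2 - 3 * int n - 1 \<le> Dressian_dim n"
proof -
  define m where "m = n div 4"
  \<comment> \<open>Cells of an addition table: row, column and sum are shifted into disjoint
    blocks. The largest entry is \<open>4 * m\<close>, hence \<open>n div 4\<close>.\<close>
  define f where "f = (\<lambda>(i, j). {i, m + j, 2 * m + i + j})"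
  define S where "S = f ` ({1..m} \<times> {1..m})"
  have m: "4 * m \<le> n" by (simp add: m_def)
  have det: "p = p'"
    if "p \<in> {1..m} \<times> {1..m}" "p' \<in> {1..m} \<times> {1..m}" "{a,b} \<subseteq> f p \<inter> f p'" "a \<noteq> b" for p p' a b
  proof -
    obtain i j where p: "p = (i, j)" by fastforce
    obtain i' j' where p': "p' = (i', j')" by fastforce
    have r: "1 \<le> i" "i \<le> m" "1 \<le> j" "j \<le> m" "1 \<le> i'" "i' \<le> m" "1 \<le> j'" "j' \<le> m"
      using that(1,2) by (auto simp: p p')
    \<comment> \<open>A common element lies in the same block for both triples. Two distinct ones
      lie in different blocks, and any two of \<open>i\<close>, \<open>j\<close>,
      \<open>i + j\<close> fix the pair.\<close>
    have block: "x = i \<and> i = i' \<or> x = m + j \<and> j = j' \<or> x = 2 * m + i + j \<and> i + j = i' + j'"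
      if "x \<in> f p" "x \<in> f p'" for x
    proof -
      have "x = i \<or> x = m + j \<or> x = 2 * m + i + j" "x = i' \<or> x = m + j' \<or> x = 2 * m + i' + j'"
        using that by (auto simp: f_def p p')
      thus ?thesis by (elim disjE) (use r in linarith)+
    qed
    have "a \<in> f p" "a \<in> f p'" "b \<in> f p" "b \<in> f p'" using that(3) by auto
    hence "i = i' \<and> j = j'"
      using block[of a] block[of b] that(4) by fastforce
    thus ?thesis by (simp add: p p')
  qed
  have "inj_on f ({1..m} \<times> {1..m})"
  proof (rule inj_onI)
    fix p p' assume p: "p \<in> {1..m} \<times> {1..m}" "p' \<in> {1..m} \<times> {1..m}" "f p = f p'"
    have "{fst p, m + snd p} \<subseteq> f p" "fst p \<noteq> m + snd p"
      using p(1) by (auto simp: f_def split: prod.splits)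
    with p show "p = p'" by (intro det[of p p' "fst p" "m + snd p"]) auto
  qed
  hence "card S = m ^ 2"
    by (simp add: S_def card_image power2_eq_square)
  moreover have "S \<subseteq> triples n"
    using m by (auto simp: S_def f_def triples_def card_insert_if)
  moreover have "A = B" if "A \<in> S" "B \<in> S" "{a,b} \<subseteq> A \<inter> B" "a \<noteq> b" for A B a b
    using that det unfolding S_def by blast
  ultimately show ?thesis
    using partial_triple_system_lower_bound[of S n] by (simp add: m_def)
qed

section \<open>From the explicit bounds to the asymptotic order\<close>

theorem theorem3p6:
  shows "(\<lambda>n. real_of_int (Dressian_dim n)) \<in> \<Theta>[at_top](\<lambda>n. real n ^ 2)"
proof (rule bigthetaI)
  \<comment> \<open>With the rounding loss the bound is at least
    \<open>n^2 / 16 - 7 * n / 2\<close>; the constants 64 and 1000 absorb the linear term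
    generously.\<close>
  have lower: "real n ^ 2 / 64 \<le> real_of_int (Dressian_dim n)" if n: "1000 \<le> n" for n
  proof -
    have "real n / 4 - 1 \<le> real (n div 4)" by linarith
    hence "(real n / 4 - 1) ^ 2 \<le> real (n div 4) ^ 2"
      using n by (intro power_mono) auto
    moreover have "(real n / 4 - 1) ^ 2 = real n ^ 2 / 16 - real n / 2 + 1"
      by (simp add: power2_eq_square field_simps)
    moreover have "real n ^ 2 \<ge> 1000 * real n"
      using n by (simp add: power2_eq_square)
    ultimately have "real n ^ 2 / 64 \<le> real (n div 4) ^ 2 - 3 * real n - 1"
      using n by linarith
    also have "\<dots> = real_of_int (int (n div 4) ^ 2 - 3 * int n - 1)" by simp
    also have "\<dots> \<le> real_of_int (Dressian_dim n)"
      using Dressian_dim_ge[of n] by (simp only: of_int_le_iff)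
    finally show ?thesis .
  qed
  have upper: "real_of_int (Dressian_dim n) \<le> 2 * real n ^ 2" for n
  proof -
    have "real_of_int (Dressian_dim n) \<le> real_of_int (2 * int n ^ 2)"
      using Dressian_dim_le[of n] by (simp only: of_int_le_iff)
    thus ?thesis by simp
  qed
  show "(\<lambda>n. real_of_int (Dressian_dim n)) \<in> O(\<lambda>n. real n ^ 2)"
  proof (rule bigoI[of _ 2], rule eventually_mono[OF eventually_ge_at_top[of 1000]])
    fix n :: nat assume "1000 \<le> n"
    \<comment> \<open>The upper estimate concerns the absolute value, and the dimension can be -1
      for small \<open>n\<close>.\<close>
    from lower[OF this] have "0 \<le> real_of_int (Dressian_dim n)"
      by (rule order_trans[rotated]) simp
    with upper[of n] show "norm (real_of_int (Dressian_dim n)) \<le> 2 * norm (real n ^ 2)" by simp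
  qed
  show "(\<lambda>n. real_of_int (Dressian_dim n)) \<in> \<Omega>(\<lambda>n. real n ^ 2)"
  proof (rule landau_omega.bigI[of "1 / 64"])
    show "eventually (\<lambda>n. norm (real_of_int (Dressian_dim n)) \<ge> 1 / 64 * norm (real n ^ 2)) at_top"
    proof (rule eventually_mono[OF eventually_ge_at_top[of 1000]])
      fix n :: nat assume "1000 \<le> n"
      from lower[OF this]
      show "norm (real_of_int (Dressian_dim n)) \<ge> 1 / 64 * norm (real n ^ 2)"
        by simp
    qed
  qed simp
qed

end
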